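(* Let $\pi\colon (\Omega,\mathrm{pr})\to(\Omega',\mathrm{pr}')$ be a bundle of probability schemes, with expectations $\mathrm{E}$ on $\mathbb{R}^{\Omega}$ and $\mathrm{E}'$ on $\mathbb{R}^{\Omega'}$. Then: (i) $\pi_{\flat}\pi^{\sharp}$ is the identity map on $\mathbb{R}^{\Omega'}$. (ii) Both $\pi^{\sharp}$ and $\pi_{\flat}$ preserve expectation: $\mathrm{E}(\pi^{\sharp}Z)=\mathrm{E}'(Z)$ for all $Z\in\mathbb{R}^{\Omega'}$, and $\mathrm{E}'(\pi_{\flat}X)=\mathrm{E}(X)$ for all $X\in\mathbb{R}^{\Omega}$. (iii) $\pi_{\flat}$ is an $\mathbb{R}^{\Omega'}$-module map, where $\mathbb{R}^{\Omega}$ is an $\mathbb{R}^{\Omega'}$-module through $\pi^{\sharp}$. (iv) $\pi^{\sharp}$ and $\pi_{\flat}$ form an adjoint pair: $\langle Z,\pi_{\flat}X\rangle_{\Omega'}=\langle \pi^{\sharp}Z,X\rangle_{\Omega}$ for all $Z\in\mathbb{R}^{\Omega'}$, $X\in\mathbb{R}^{\Omega}$. (v) $\mathrm{E}_{\pi}:=\pi^{\sharp}\pi_{\flat}$ is the orthogonal projection of $\mathbb{R}^{\Omega}$ onto $\mathcal{A}_{\pi}:=\pi^{\sharp}(\mathbb{R}^{\Omega'})$ with respect to $\langle\cdot,\cdot\rangle_{\Omega}$. (vi) $\pi^{\sharp}$ is an isometry: $\langle\pi^{\sharp}Z,\pi^{\sharp}Z'\rangle_{\Omega}=\langle Z,Z'\rangle_{\Omega'}$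 for all $Z,Z'\in\mathbb{R}^{\Omega'}$.
   Context: A (probability) scheme is a finite set $\Omega$ with a function $\mathrm{pr}\colon\Omega\to(0,\infty)$ such that $\sum_{\omega}\mathrm{pr}(\omega)=1$. $\mathbb{R}^{\Omega}$ is the real algebra of functions $\Omega\to\mathbb{R}$ under pointwise operations. The expectation is $\mathrm{E}X=\sum_{\omega\in\Omega}X(\omega)\mathrm{pr}(\omega)$, and $\langle X,Y\rangle_{\Omega}:=\mathrm{E}(XY)$ is an inner product on $\mathbb{R}^{\Omega}$. A bundle $\pi\colon(\Omega,\mathrm{pr})\to(\Omega',\mathrm{pr}')$ is a map $\pi\colon\Omega\to\Omega'$ such that the probability of the preimage of every subset of $\Omega'$ equals the probability of that subset (equivalently $\mathrm{pr}'(\omega')=\sum_{\omega\in\pi^{-1}(\omega')}\mathrm{pr}(\omega)$ for all $\omega'$); such a map is automatically surjective. The pullback is $\pi^{\sharp}\colon\mathbb{R}^{\Omega'}\to\mathbb{R}^{\Omega}$, $\pi^{\sharp}(Z)=Z\circ\pi$; through it, $Z\in\mathbb{R}^{\Omega'}$ acts on $X\in\mathbb{R}^{\Omega}$ by $(\pi^{\sharp}Z)X$. The transfer $\pi_*\colon\mathbb{R}^{\Omega}\to\mathbb{R}^{\Omega'}$ is $(\pi_*X)(\omega')=\sum_{\omega\in\pi^{-1}(\omega')}X(\omega)$. The fiberwise averaging map $\pi_{\flat}\colon\mathbb{R}^{\Omega}\to\mathbb{R}^{\Omega'}$ is $\pi_{\flat}X=\pi_*(X\,\mathrm{pr})/\mathrm{pr}'$.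 *)

theory Defs
  imports Complex_Main "HOL-Library.Function_Algebras"
begin

text \<open>
  The finite set underlying a probability scheme is a type of class \<open>finite\<close>, and the algebra of
  real functions on it is the function type \<open>'a \<Rightarrow> real\<close> with the pointwise ring operations of
  \<open>Function_Algebras\<close>.
\<close>

definition prob_scheme :: "('a::finite \<Rightarrow> real) \<Rightarrow> bool" where
  "prob_scheme pr \<longleftrightarrow> (\<forall>\<omega>. pr \<omega> > 0) \<and> (\<Sum>\<omega>\<in>UNIV. pr \<omega>) = 1"

definition expect :: "('a::finite \<Rightarrow> real) \<Rightarrow> ('a \<Rightarrow> real) \<Rightarrow> real" where
  "expect pr X = (\<Sum>\<omega>\<in>UNIV. X \<omega> * pr \<omega>)"

definition inner_prod :: "('a::finite \<Rightarrow> real) \<Rightarrow> ('a \<Rightarrow> real) \<Rightarrow> ('a \<Rightarrow> real) \<Rightarrow> real" where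
  "inner_prod pr X Y = expect pr (X * Y)"

definition scheme_bundle ::
    "('a::finite \<Rightarrow> real) \<Rightarrow> ('b::finite \<Rightarrow> real) \<Rightarrow> ('a \<Rightarrow> 'b) \<Rightarrow> bool" where
  "scheme_bundle pr pr' \<pi> \<longleftrightarrow> prob_scheme pr \<and> prob_scheme pr' \<and>
     (\<forall>A. (\<Sum>\<omega>\<in>\<pi> -` A. pr \<omega>) = (\<Sum>\<omega>'\<in>A. pr' \<omega>'))"

definition pullback :: "('a \<Rightarrow> 'b) \<Rightarrow> ('b \<Rightarrow> real) \<Rightarrow> ('a \<Rightarrow> real)" where
  "pullback \<pi> Z = Z \<circ> \<pi>"

definition pushforward :: "('a::finite \<Rightarrow> 'b) \<Rightarrow> ('a \<Rightarrow> real) \<Rightarrow> ('b \<Rightarrow> real)" where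
  "pushforward \<pi> X = (\<lambda>\<omega>'. \<Sum>\<omega>\<in>\<pi> -` {\<omega>'}. X \<omega>)"

definition fiber_avg ::
    "('a::finite \<Rightarrow> real) \<Rightarrow> ('b \<Rightarrow> real) \<Rightarrow> ('a \<Rightarrow> 'b) \<Rightarrow> ('a \<Rightarrow> real) \<Rightarrow> ('b \<Rightarrow> real)" where
  "fiber_avg pr pr' \<pi> X = (\<lambda>\<omega>'. pushforward \<pi> (X * pr) \<omega>' / pr' \<omega>')"

definition cond_expect ::
    "('a::finite \<Rightarrow> real) \<Rightarrow> ('b \<Rightarrow> real) \<Rightarrow> ('a \<Rightarrow> 'b) \<Rightarrow> ('a \<Rightarrow> real) \<Rightarrow> ('a \<Rightarrow> real)" where
  "cond_expect pr pr' \<pi> = pullback \<pi> \<circ> fiber_avg pr pr' \<pi>"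

definition fiber_algebra :: "('a \<Rightarrow> 'b) \<Rightarrow> ('a \<Rightarrow> real) set" where
  "fiber_algebra \<pi> = range (pullback \<pi>)"

definition fun_scale :: "real \<Rightarrow> ('a \<Rightarrow> real) \<Rightarrow> ('a \<Rightarrow> real)" where
  "fun_scale c X = (\<lambda>\<omega>. c * X \<omega>)"

text \<open>
  Function types carry no \<open>real_vector\<close> instance, so real linearity is stated with the locale
  \<open>Vector_Spaces.linear\<close>, which takes the scalar multiplications explicitly. Orthogonality is with
  respect to an arbitrary form \<open>ip\<close>.
\<close>

definition orthogonal_projection_onto ::
    "(('a \<Rightarrow> real) \<Rightarrow> ('a \<Rightarrow> real) \<Rightarrow> real) \<Rightarrow> ('a \<Rightarrow> real) set \<Rightarrow>
     (('a \<Rightarrow> real) \<Rightarrow> ('a \<Rightarrow> real)) \<Rightarrow> bool" where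
  "orthogonal_projection_onto ip V P \<longleftrightarrow>
     Vector_Spaces.linear fun_scale fun_scale P \<and>
     P \<circ> P = P \<and>
     range P = V \<and>
     (\<forall>X. \<forall>Y\<in>V. ip (X - P X) Y = 0)"

end

theory Submission
  imports Defs
begin

text \<open>
  Everything follows from three facts: averaging satisfies the projection formula
  \<open>\<pi>\<^sub>\<flat>(\<pi>\<^sup>\<sharp>Z \<cdot> X) = Z \<cdot> \<pi>\<^sub>\<flat>X\<close>, it preserves expectation (sum over the fibers), and it sends \<open>1\<close> to \<open>1\<close>.
  Putting \<open>X = 1\<close> gives \<open>\<pi>\<^sub>\<flat>\<pi>\<^sup>\<sharp> = id\<close>; taking expectations in the projection formula gives adjointness; and
  the statements on \<open>\<pi>\<^sup>\<sharp>\<pi>\<^sub>\<flat>\<close> and on the isometry are formal consequences of these two.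
\<close>

lemma scheme_bundle_pos: "scheme_bundle pr pr' \<pi> \<Longrightarrow> pr' \<omega>' > 0"
  by (simp add: scheme_bundle_def prob_scheme_def)

lemma scheme_bundle_fiber:
  assumes "scheme_bundle pr pr' \<pi>"
  shows "(\<Sum>\<omega>\<in>\<pi> -` {\<omega>'}. pr \<omega>) = pr' \<omega>'"
proof -
  have "(\<Sum>\<omega>\<in>\<pi> -` {\<omega>'}. pr \<omega>) = (\<Sum>\<omega>'\<in>{\<omega>'}. pr' \<omega>')"
    using assms unfolding scheme_bundle_def by blast
  then show ?thesis by simp
qed

text \<open>The fibers of \<open>\<pi>\<close> partition the domain; points with empty fiber
  contribute 0.\<close>

lemma sum_pushforward:
  fixes \<pi> :: "'a::finite \<Rightarrow> 'b::finite"
  shows "(\<Sum>\<omega>'\<in>UNIV. pushforward \<pi> X \<omega>') = (\<Sum>\<omega>\<in>UNIV. X \<omega>)"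
  using sum.group[of UNIV UNIV \<pi> X] by (simp add: pushforward_def vimage_def)

lemma pullback_mult: "pullback \<pi> (Z * Z') = pullback \<pi> Z * pullback \<pi> Z'"
  by (simp add: pullback_def fun_eq_iff)

lemma pullback_add: "pullback \<pi> (Z + Z') = pullback \<pi> Z + pullback \<pi> Z'"
  by (simp add: pullback_def fun_eq_iff)

lemma pullback_one: "pullback \<pi> 1 = 1"
  by (simp add: pullback_def fun_eq_iff)

lemma pullback_fun_scale: "pullback \<pi> (fun_scale c Z) = fun_scale c (pullback \<pi> Z)"
  by (simp add: pullback_def fun_scale_def fun_eq_iff)

lemma fiber_avg_add: "fiber_avg pr pr' \<pi> (X + Y) = fiber_avg pr pr' \<pi> X + fiber_avg pr pr' \<pi> Y"
  by (simp add: fiber_avg_def pushforward_def fun_eq_iff distrib_right sum.distrib add_divide_distrib)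

text \<open>A pulled-back function is constant on each fiber, so it factors out of the fiber
  sum.\<close>

lemma fiber_avg_pullback_mult:
  "fiber_avg pr pr' \<pi> (pullback \<pi> Z * X) = Z * fiber_avg pr pr' \<pi> X"
  by (simp add: fiber_avg_def pushforward_def pullback_def fun_eq_iff sum_distrib_left mult.assoc)

text \<open>Constants are pullbacks of constants, so homogeneity of averaging becomes a case of the
  projection formula.\<close>

lemma fun_scale_eq_mult: "fun_scale c X = pullback \<pi> (\<lambda>_. c) * X"
  by (simp add: fun_scale_def pullback_def fun_eq_iff)

lemma fiber_avg_fun_scale:
  "fiber_avg pr pr' \<pi> (fun_scale c X) = fun_scale c (fiber_avg pr pr' \<pi> X)"
  by (subst fun_scale_eq_mult[of c X \<pi>])
    (simp add: fiber_avg_pullback_mult fun_scale_def fun_eq_iff)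

text \<open>Each numerator is the mass of a fiber, hence equal to \<open>pr'\<close>; positivity of
  \<open>pr'\<close> makes the quotient 1 instead of the default value 0 of division by
  zero.\<close>

lemma fiber_avg_one:
  assumes "scheme_bundle pr pr' \<pi>"
  shows "fiber_avg pr pr' \<pi> 1 = 1"
  using scheme_bundle_fiber[OF assms] scheme_bundle_pos[OF assms]
  by (simp add: fiber_avg_def pushforward_def fun_eq_iff less_imp_neq[symmetric])

lemma fiber_avg_pullback:
  assumes "scheme_bundle pr pr' \<pi>"
  shows "fiber_avg pr pr' \<pi> (pullback \<pi> Z) = Z"
  using fiber_avg_pullback_mult[of pr pr' \<pi> Z 1] by (simp add: fiber_avg_one[OF assms])

lemma expect_fiber_avg:
  assumes "scheme_bundle pr pr' \<pi>"
  shows "expect pr' (fiber_avg pr pr' \<pi> X) = expect pr X"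
proof -
  \<comment> \<open>The weight \<open>pr'\<close> in the expectation cancels the denominator of the
    average.\<close>
  have "expect pr' (fiber_avg pr pr' \<pi> X) = (\<Sum>\<omega>'\<in>UNIV. pushforward \<pi> (X * pr) \<omega>')"
    using scheme_bundle_pos[OF assms]
    by (simp add: expect_def fiber_avg_def less_imp_neq[symmetric])
  then show ?thesis by (simp add: sum_pushforward expect_def)
qed

lemma expect_pullback:
  assumes "scheme_bundle pr pr' \<pi>"
  shows "expect pr (pullback \<pi> Z) = expect pr' Z"
  using expect_fiber_avg[OF assms, of "pullback \<pi> Z"] by (simp add: fiber_avg_pullback[OF assms])

lemma inner_prod_fiber_avg:
  assumes "scheme_bundle pr pr' \<pi>"
  shows "inner_prod pr' Z (fiber_avg pr pr' \<pi> X) = inner_prod pr (pullback \<pi> Z) X"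
  by (simp add: inner_prod_def fiber_avg_pullback_mult[symmetric] expect_fiber_avg[OF assms])

lemma inner_prod_pullback:
  assumes "scheme_bundle pr pr' \<pi>"
  shows "inner_prod pr (pullback \<pi> Z) (pullback \<pi> Z') = inner_prod pr' Z Z'"
  by (simp add: inner_prod_def pullback_mult[symmetric] expect_pullback[OF assms])

lemma inner_prod_diff_left: "inner_prod pr (X - X') Y = inner_prod pr X Y - inner_prod pr X' Y"
  by (simp add: inner_prod_def expect_def left_diff_distrib sum_subtractf)

lemma inner_prod_commute: "inner_prod pr X Y = inner_prod pr Y X"
  by (simp add: inner_prod_def mult.commute)

lemma vector_space_fun_scale: "vector_space fun_scale"
  by unfold_locales (simp_all add: fun_scale_def fun_eq_iff algebra_simps)

text \<open>The scalars are the function ring on the base, acting on itself by multiplication. The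
  locale also demands the module axioms for both actions; upstairs they hold because pullback is a
  unital ring homomorphism.\<close>

lemma module_hom_fiber_avg:
  "module_hom (\<lambda>Z X. pullback \<pi> Z * X) (\<lambda>Z W. Z * W) (fiber_avg pr pr' \<pi>)"
  by unfold_locales
    (simp_all add: pullback_add pullback_mult pullback_one fiber_avg_add fiber_avg_pullback_mult
      distrib_left distrib_right mult.assoc)

lemma linear_cond_expect:
  "Vector_Spaces.linear fun_scale fun_scale (cond_expect pr pr' \<pi>)"
  by (simp add: Vector_Spaces.linear_iff vector_space_fun_scale cond_expect_def fiber_avg_add
      fiber_avg_fun_scale pullback_add pullback_fun_scale)

lemma orthogonal_projection_cond_expect:
  assumes "scheme_bundle pr pr' \<pi>"
  shows "orthogonal_projection_onto (inner_prod pr) (fiber_algebra \<pi>) (cond_expect pr pr' \<pi>)"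
  unfolding orthogonal_projection_onto_def
proof (intro conjI allI ballI linear_cond_expect)
  show "cond_expect pr pr' \<pi> \<circ> cond_expect pr pr' \<pi> = cond_expect pr pr' \<pi>"
    by (simp add: cond_expect_def fun_eq_iff fiber_avg_pullback[OF assms])
  \<comment> \<open>Since averaging hits every function on the base, composing with it does not
    shrink the range of the pullback.\<close>
  have "surj (fiber_avg pr pr' \<pi>)"
    by (rule surjI[where g = "fiber_avg pr pr' \<pi>" and f = "pullback \<pi>"])
      (rule fiber_avg_pullback[OF assms])
  then show "range (cond_expect pr pr' \<pi>) = fiber_algebra \<pi>"
    by (simp add: cond_expect_def fiber_algebra_def image_comp[symmetric] del: comp_apply o_apply)
next
  fix X Y assume "Y \<in> fiber_algebra \<pi>"
  then obtain Z where Y: "Y = pullback \<pi> Z"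
    by (auto simp: fiber_algebra_def)
  \<comment> \<open>Both arguments are pullbacks, so the isometry moves the pairing down to the
    base; adjointness then lifts it back with \<open>X\<close> in place of its projection.\<close>
  have "inner_prod pr (cond_expect pr pr' \<pi> X) Y = inner_prod pr' (fiber_avg pr pr' \<pi> X) Z"
    by (simp add: Y cond_expect_def inner_prod_pullback[OF assms])
  also have "\<dots> = inner_prod pr X Y"
    by (simp add: Y inner_prod_commute[of pr' _ Z] inner_prod_commute[of pr X]
        inner_prod_fiber_avg[OF assms])
  finally show "inner_prod pr (X - cond_expect pr pr' \<pi> X) Y = 0"
    by (simp add: inner_prod_diff_left)
qed

theorem theorem3:
  fixes pr :: "'a::finite \<Rightarrow> real" and pr' :: "'b::finite \<Rightarrow> real" and \<pi> :: "'a \<Rightarrow> 'b"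
  assumes "scheme_bundle pr pr' \<pi>"
  shows "(fiber_avg pr pr' \<pi> \<circ> pullback \<pi> = id) \<and>
    ((\<forall>Z. expect pr (pullback \<pi> Z) = expect pr' Z) \<and>
         (\<forall>X. expect pr' (fiber_avg pr pr' \<pi> X) = expect pr X)) \<and>
    module_hom (\<lambda>Z X. pullback \<pi> Z * X) (\<lambda>Z W. Z * W) (fiber_avg pr pr' \<pi>) \<and>
    (\<forall>Z X. inner_prod pr' Z (fiber_avg pr pr' \<pi> X) = inner_prod pr (pullback \<pi> Z) X) \<and>
    orthogonal_projection_onto (inner_prod pr) (fiber_algebra \<pi>) (cond_expect pr pr' \<pi>) \<and>
    (\<forall>Z Z'. inner_prod pr (pullback \<pi> Z) (pullback \<pi> Z') = inner_prod pr' Z Z')"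
proof (intro conjI allI)
  show "fiber_avg pr pr' \<pi> \<circ> pullback \<pi> = id"
    by (simp add: fun_eq_iff fiber_avg_pullback[OF assms])
qed (use assms in \<open>simp_all add: expect_pullback expect_fiber_avg module_hom_fiber_avg
      inner_prod_fiber_avg orthogonal_projection_cond_expect inner_prod_pullback\<close>)

end
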